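(* Let $t\in\{0,\dots,d\}$ and let $$S_3^t:=\bigcup_{\mathcal{T}\subseteq[d],\ |\mathcal{T}|=d-t}S_3^{\mathcal{T}},$$ where $S_3^{\mathcal{T}}:=\{\bm{y}\in\mathbb{R}^d:\ \exists\,\bm{x}\in\hat U\text{ with }\bm{y}_{\mathcal{T}}=\bm{x}_{\mathcal{T}},\ \text{and } y_\ell\in U_\ell\text{ for every }\ell\notin\mathcal{T}\}$. Then $$v_I(S_3^t)\le\Big(1+\frac{d-t}{d}\Big)v_I^* .$$
   Context: Notation: $[k]=\{1,\dots,k\}$. For $i\in[k]$, $\mathbb{P}_i=\sum_{j\in[|\Xi_i|]}\hat p_{ij}\delta_{\hat{\bm{x}}_{ij}}$ is a probability measure supported on a nonempty finite set $\Xi_i=\{\hat{\bm{x}}_{ij}\}_j\subseteq\mathbb{R}^d$ with $|\Xi_i|\le n$ ($d\ge1$). Weights satisfy $\lambda_i\ge0$ and $\sum_{i\in[k]}\lambda_i=1$. The type-1 barycenter value is $v_I^*=\inf_{\mathbb{P}}\sum_{i\in[k]}\lambda_iW_1(\mathbb{P},\mathbb{P}_i)$, the infimum over Borel probability measures on $\mathbb{R}^d$ with finite first moment, where $W_1(\mathbb{P},\mathbb{Q})=\inf_{\Pi}\int\|\bm{x}-\bm{y}\|_1\,d\Pi(\bm{x},\bm{y})$ over couplings $\Pi$ of $\mathbb{P},\mathbb{Q}$ (note the $\ell_1$ norm). For a nonempty finite set $S\subseteq\mathbb{R}^d$, $v_I(S)$ is the value of the type-1 restricted multi-marginal optimal transport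 problem: the minimum of $\sum_{\vec{\bm{j}}}C^{(1)}_{\vec{\bm{j}}}(S)\Pi_{\vec{\bm{j}}}$ over nonnegative tensors $\bm\Pi$ indexed by $\vec{\bm{j}}=(j_1,\dots,j_k)\in\prod_{i\in[k]}[|\Xi_i|]$ whose $i$-th marginal is $(\hat p_{ij})_j$ for every $i\in[k]$, where $C^{(1)}_{\vec{\bm{j}}}(S)=\min_{\bm{w}\in S}\sum_{i\in[k]}\lambda_i\|\bm{w}-\hat{\bm{x}}_{i,j_i}\|_1$. $\hat U:=\bigcup_{i\in[k]}\Xi_i$; $U_\ell:=\{x_\ell:\bm{x}\in\hat U\}$ for $\ell\in[d]$; $\bm{x}_{\mathcal{T}}$ is the subvector of $\bm{x}$ with coordinates in $\mathcal{T}$. *)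

theory Defs
  imports "HOL-Probability.Probability"
begin

section \<open>Type-1 Wasserstein distance and barycenter value\<close>

definition norm1 :: "real ^ 'd \<Rightarrow> real" where
  "norm1 x = (\<Sum>l\<in>UNIV. \<bar>x $ l\<bar>)"

definition couplings ::
    "(real ^ 'd) measure \<Rightarrow> (real ^ 'd) measure \<Rightarrow> ((real ^ 'd) \<times> (real ^ 'd)) measure set" where
  "couplings P Q = {\<pi>. prob_space \<pi> \<and> sets \<pi> = sets (borel \<Otimes>\<^sub>M borel)
     \<and> distr \<pi> borel fst = P \<and> distr \<pi> borel snd = Q}"

text \<open>Values live in \<^typ>\<open>ennreal\<close>, so that a non-integrable cost counts as infinite.\<close>

definition W1 :: "(real ^ 'd) measure \<Rightarrow> (real ^ 'd) measure \<Rightarrow> ennreal" where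
  "W1 P Q = (INF \<pi>\<in>couplings P Q. \<integral>\<^sup>+ z. ennreal (norm1 (fst z - snd z)) \<partial>\<pi>)"

definition prob_measures1 :: "(real ^ 'd) measure set" where
  "prob_measures1 = {P. prob_space P \<and> sets P = sets borel \<and> (\<integral>\<^sup>+ x. ennreal (norm1 x) \<partial>P) < \<infinity>}"

definition barycenter_value ::
    "nat \<Rightarrow> (nat \<Rightarrow> real) \<Rightarrow> (nat \<Rightarrow> (real ^ 'd) measure) \<Rightarrow> ennreal" where
  "barycenter_value k lam P =
     (INF Q\<in>prob_measures1. \<Sum>i\<in>{1..k}. ennreal (lam i) * W1 Q (P i))"

text \<open>The measure with mass \<open>p j\<close> at the point \<open>x j\<close>, for \<open>j = 1, \<dots>, m\<close>;
  see \<open>emeasure_discrete_measure\<close> below.\<close>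

definition discrete_measure ::
    "nat \<Rightarrow> (nat \<Rightarrow> real) \<Rightarrow> (nat \<Rightarrow> real ^ 'd) \<Rightarrow> (real ^ 'd) measure" where
  "discrete_measure m p x = distr (point_measure {1..m} (\<lambda>j. ennreal (p j))) borel x"


section \<open>Restricted multi-marginal optimal transport\<close>

text \<open>Throughout, \<open>m i\<close> is the number of support points of the \<open>i\<close>-th measure, \<open>x i j\<close> its
  \<open>j\<close>-th support point and \<open>p i j\<close> the mass there, with \<open>i \<in> {1..k}\<close> and \<open>j \<in> {1..m i}\<close>.
  A multi-index is a function in \<open>multi_indices k m\<close>; only the entries of a tensor at
  multi-indices matter.\<close>

definition multi_indices :: "nat \<Rightarrow> (nat \<Rightarrow> nat) \<Rightarrow> (nat \<Rightarrow> nat) set" where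
  "multi_indices k m = (\<Pi>\<^sub>E i\<in>{1..k}. {1..m i})"

definition mmot_cost ::
    "nat \<Rightarrow> (nat \<Rightarrow> real) \<Rightarrow> (nat \<Rightarrow> nat \<Rightarrow> real ^ 'd) \<Rightarrow> (real ^ 'd) set \<Rightarrow> (nat \<Rightarrow> nat) \<Rightarrow> real" where
  "mmot_cost k lam x S j = Min ((\<lambda>w. \<Sum>i\<in>{1..k}. lam i * norm1 (w - x i (j i))) ` S)"

definition mmot_feasible ::
    "nat \<Rightarrow> (nat \<Rightarrow> nat) \<Rightarrow> (nat \<Rightarrow> nat \<Rightarrow> real) \<Rightarrow> ((nat \<Rightarrow> nat) \<Rightarrow> real) set" where
  "mmot_feasible k m p = {\<pi>. (\<forall>j\<in>multi_indices k m. 0 \<le> \<pi> j)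
     \<and> (\<forall>i\<in>{1..k}. \<forall>l\<in>{1..m i}. (\<Sum>j\<in>{j \<in> multi_indices k m. j i = l}. \<pi> j) = p i l)}"

definition mmot_value ::
    "nat \<Rightarrow> (nat \<Rightarrow> real) \<Rightarrow> (nat \<Rightarrow> nat) \<Rightarrow> (nat \<Rightarrow> nat \<Rightarrow> real) \<Rightarrow> (nat \<Rightarrow> nat \<Rightarrow> real ^ 'd) \<Rightarrow>
     (real ^ 'd) set \<Rightarrow> real" where
  "mmot_value k lam m p x S =
     (INF \<pi>\<in>mmot_feasible k m p. \<Sum>j\<in>multi_indices k m. mmot_cost k lam x S j * \<pi> j)"


section \<open>The candidate support sets\<close>

definition support_union ::
    "nat \<Rightarrow> (nat \<Rightarrow> nat) \<Rightarrow> (nat \<Rightarrow> nat \<Rightarrow> real ^ 'd) \<Rightarrow> (real ^ 'd) set" where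
  "support_union k m x = (\<Union>i\<in>{1..k}. x i ` {1..m i})"

definition coord_values :: "(real ^ 'd) set \<Rightarrow> 'd \<Rightarrow> real set" where
  "coord_values U l = (\<lambda>y. y $ l) ` U"

definition S3_set :: "(real ^ 'd) set \<Rightarrow> 'd set \<Rightarrow> (real ^ 'd) set" where
  "S3_set U T = {y. (\<exists>x\<in>U. \<forall>l\<in>T. y $ l = x $ l) \<and> (\<forall>l. l \<notin> T \<longrightarrow> y $ l \<in> coord_values U l)}"

definition S3 :: "(real ^ 'd) set \<Rightarrow> nat \<Rightarrow> (real ^ 'd) set" where
  "S3 U t = (\<Union>T\<in>{T. card T = CARD('d) - t}. S3_set U T)"


section \<open>Well-definedness\<close>

lemma emeasure_discrete_measure:
  assumes "A \<in> sets borel"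
  shows "emeasure (discrete_measure m p x) A = (\<Sum>j\<in>{1..m}. ennreal (p j) * indicator A (x j))"
proof -
  have m: "x \<in> measurable (point_measure {1..m} (\<lambda>j. ennreal (p j))) borel"
    by (auto simp: measurable_def sets_point_measure space_point_measure)
  have "emeasure (discrete_measure m p x) A
      = emeasure (point_measure {1..m} (\<lambda>j. ennreal (p j))) (x -` A \<inter> {1..m})"
    unfolding discrete_measure_def using m assms
    by (simp add: emeasure_distr space_point_measure)
  also have "\<dots> = (\<Sum>j\<in>x -` A \<inter> {1..m}. ennreal (p j))"
    by (rule emeasure_point_measure_finite) auto
  also have "\<dots> = (\<Sum>j\<in>{1..m}. ennreal (p j) * indicator A (x j))"
    by (rule sum.mono_neutral_cong_left) (auto simp: indicator_def)
  finally show ?thesis .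
qed

lemma norm1_measurable [measurable]: "norm1 \<in> borel_measurable borel"
  unfolding norm1_def[abs_def]
  by (intro borel_measurable_continuous_onI continuous_intros)

lemma discrete_measure_in_prob_measures1:
  fixes x :: "nat \<Rightarrow> real ^ 'd"
  assumes "\<And>j. j \<in> {1..m} \<Longrightarrow> 0 \<le> p j" and "(\<Sum>j\<in>{1..m}. p j) = 1"
  shows "discrete_measure m p x \<in> prob_measures1"
proof -
  have m: "x \<in> measurable (point_measure {1..m} (\<lambda>j. ennreal (p j))) borel"
    by (auto simp: measurable_def sets_point_measure space_point_measure)
  have "emeasure (discrete_measure m p x) UNIV = (\<Sum>j\<in>{1..m}. ennreal (p j))"
    by (simp add: emeasure_discrete_measure)
  also have "\<dots> = 1"
    using assms by (subst sum_ennreal) auto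
  finally have 1: "prob_space (discrete_measure m p x)"
    by (intro prob_spaceI) (simp add: discrete_measure_def)
  have "(\<integral>\<^sup>+ y. ennreal (norm1 y) \<partial>discrete_measure m p x)
      = (\<Sum>j\<in>{1..m}. ennreal (norm1 (x j)) * ennreal (p j))"
    unfolding discrete_measure_def using m
    by (subst nn_integral_distr) (auto simp: nn_integral_point_measure_finite mult.commute)
  also have "\<dots> < \<infinity>"
    by (simp add: ennreal_mult_less_top)
  finally show ?thesis
    using 1 by (simp add: prob_measures1_def discrete_measure_def)
qed

lemma norm1_nonneg: "0 \<le> norm1 x"
  by (simp add: norm1_def sum_nonneg)

lemma norm1_diff_le: "norm1 (x - y) \<le> norm1 x + norm1 y"
  unfolding norm1_def sum.distrib[symmetric] by (intro sum_mono) auto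

lemma W1_less_top:
  fixes P Q :: "(real ^ 'd) measure"
  assumes "P \<in> prob_measures1" "Q \<in> prob_measures1"
  shows "W1 P Q < \<infinity>"
proof -
  interpret P: prob_space P using assms by (simp add: prob_measures1_def)
  interpret Q: prob_space Q using assms by (simp add: prob_measures1_def)
  interpret PQ: pair_prob_space P Q ..
  have sP [measurable_cong]: "sets P = sets borel" and sQ [measurable_cong]: "sets Q = sets borel"
    using assms by (auto simp: prob_measures1_def)
  have sPQ: "sets (P \<Otimes>\<^sub>M Q) = sets (borel \<Otimes>\<^sub>M borel)"
    by (intro sets_pair_measure_cong sP sQ)
  have f: "distr (P \<Otimes>\<^sub>M Q) borel fst = P"
    using Q.distr_pair_fst[of P] distr_cong[OF refl sP, of "P \<Otimes>\<^sub>M Q" fst fst] by simp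
  have s: "distr (P \<Otimes>\<^sub>M Q) borel snd = Q"
  proof (rule measure_eqI)
    fix A assume A: "A \<in> sets (distr (P \<Otimes>\<^sub>M Q) borel snd)"
    have "snd -` A \<inter> space (P \<Otimes>\<^sub>M Q) = space P \<times> A"
      using A sets.sets_into_space[of A Q] sQ by (auto simp: space_pair_measure)
    then show "emeasure (distr (P \<Otimes>\<^sub>M Q) borel snd) A = emeasure Q A"
      using A sQ by (simp add: emeasure_distr Q.emeasure_pair_measure_Times P.emeasure_space_1)
  qed (simp add: sQ)
  have c: "P \<Otimes>\<^sub>M Q \<in> couplings P Q"
    using f s sPQ PQ.prob_space_axioms by (simp add: couplings_def)
  have "W1 P Q \<le> (\<integral>\<^sup>+ z. ennreal (norm1 (fst z - snd z)) \<partial>(P \<Otimes>\<^sub>M Q))"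
    unfolding W1_def by (rule INF_lower[OF c])
  also have "\<dots> \<le> (\<integral>\<^sup>+ z. ennreal (norm1 (fst z)) + ennreal (norm1 (snd z)) \<partial>(P \<Otimes>\<^sub>M Q))"
    by (intro nn_integral_mono)
      (simp add: norm1_diff_le norm1_nonneg ennreal_leI flip: ennreal_plus)
  also have "\<dots> = (\<integral>\<^sup>+ z. ennreal (norm1 (fst z)) \<partial>(P \<Otimes>\<^sub>M Q))
      + (\<integral>\<^sup>+ z. ennreal (norm1 (snd z)) \<partial>(P \<Otimes>\<^sub>M Q))"
    by (rule nn_integral_add) measurable
  also have "(\<integral>\<^sup>+ z. ennreal (norm1 (fst z)) \<partial>(P \<Otimes>\<^sub>M Q)) = (\<integral>\<^sup>+ x. ennreal (norm1 x) \<partial>P)"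
    by (subst (2) f[symmetric], subst nn_integral_distr) auto
  also have "(\<integral>\<^sup>+ z. ennreal (norm1 (snd z)) \<partial>(P \<Otimes>\<^sub>M Q)) = (\<integral>\<^sup>+ x. ennreal (norm1 x) \<partial>Q)"
    by (subst (2) s[symmetric], subst nn_integral_distr) auto
  also have "(\<integral>\<^sup>+ x. ennreal (norm1 x) \<partial>P) + (\<integral>\<^sup>+ x. ennreal (norm1 x) \<partial>Q) < \<infinity>"
    using assms by (simp add: prob_measures1_def)
  finally show ?thesis .
qed

lemma barycenter_value_less_top:
  assumes "\<And>i. i \<in> {1..k} \<Longrightarrow> P i \<in> prob_measures1" and "1 \<le> k"
  shows "barycenter_value k lam P < \<infinity>"
proof -
  have "barycenter_value k lam P \<le> (\<Sum>i\<in>{1..k}. ennreal (lam i) * W1 (P 1) (P i))"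
    unfolding barycenter_value_def using assms by (intro INF_lower) auto
  also have "\<dots> < \<infinity>"
  proof -
    have "W1 (P 1) (P i) < \<infinity>" if "i \<in> {1..k}" for i
      using assms that by (intro W1_less_top) auto
    then show ?thesis by (simp add: ennreal_mult_less_top)
  qed
  finally show ?thesis .
qed

lemma mmot_feasible_nonempty:
  assumes "\<And>i j. i \<in> {1..k} \<Longrightarrow> j \<in> {1..m i} \<Longrightarrow> 0 \<le> p i j"
    and "\<And>i. i \<in> {1..k} \<Longrightarrow> (\<Sum>j\<in>{1..m i}. p i j) = 1"
  shows "mmot_feasible k m p \<noteq> {}"
proof -
  define \<pi> where "\<pi> j = (\<Prod>i\<in>{1..k}. p i (j i))" for j
  have "(\<Sum>j\<in>{j \<in> multi_indices k m. j i = l}. \<pi> j) = p i l"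
    if i: "i \<in> {1..k}" and l: "l \<in> {1..m i}" for i l
  proof -
    have e: "{j \<in> multi_indices k m. j i = l} = (\<Pi>\<^sub>E i'\<in>{1..k}. if i' = i then {l} else {1..m i'})"
    proof (intro set_eqI iffI)
      fix j assume "j \<in> {j \<in> multi_indices k m. j i = l}"
      then show "j \<in> (\<Pi>\<^sub>E i'\<in>{1..k}. if i' = i then {l} else {1..m i'})"
        by (simp add: multi_indices_def PiE_iff)
    next
      fix j assume j: "j \<in> (\<Pi>\<^sub>E i'\<in>{1..k}. if i' = i then {l} else {1..m i'})"
      have ji: "j i = l"
        using PiE_mem[OF j i] by simp
      have "j i' \<in> {1..m i'}" if "i' \<in> {1..k}" for i'
        using PiE_mem[OF j that] l by (cases "i' = i") simp_all
      then have "j \<in> multi_indices k m"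
        using j unfolding multi_indices_def PiE_iff by blast
      with ji show "j \<in> {j \<in> multi_indices k m. j i = l}" by simp
    qed
    have "(\<Sum>j\<in>{j \<in> multi_indices k m. j i = l}. \<pi> j)
        = (\<Prod>i'\<in>{1..k}. \<Sum>l'\<in>(if i' = i then {l} else {1..m i'}). p i' l')"
      unfolding e \<pi>_def by (rule prod_sum_PiE[symmetric]) auto
    also have "\<dots> = (\<Prod>i'\<in>{1..k}. if i' = i then p i l else 1)"
      using assms(2) by (intro prod.cong refl) simp
    also have "\<dots> = p i l"
      using i by (simp add: prod.delta)
    finally show ?thesis .
  qed
  moreover have "0 \<le> \<pi> j" if "j \<in> multi_indices k m" for j
    unfolding \<pi>_def using that assms(1) by (intro prod_nonneg) (auto simp: multi_indices_def PiE_iff)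
  ultimately have "\<pi> \<in> mmot_feasible k m p"
    unfolding mmot_feasible_def by blast
  then show ?thesis by blast
qed

lemma finite_S3:
  fixes U :: "(real ^ 'd) set"
  assumes "finite U"
  shows "finite (S3 U t)"
proof -
  have "S3 U t \<subseteq> {y. \<forall>l. y $ l \<in> coord_values U l}"
    by (auto simp: S3_def S3_set_def coord_values_def)
  moreover have "finite {y. \<forall>l. y $ l \<in> coord_values U l}"
  proof (rule finite_subset)
    show "{y. \<forall>l. y $ l \<in> coord_values U l}
        \<subseteq> vec_lambda ` (\<Pi>\<^sub>E l\<in>UNIV. coord_values U l)"
    proof
      fix y assume "y \<in> {y. \<forall>l. y $ l \<in> coord_values U l}"
      then have "vec_nth y \<in> (\<Pi>\<^sub>E l\<in>UNIV. coord_values U l)"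
        by (simp add: PiE_iff)
      then show "y \<in> vec_lambda ` (\<Pi>\<^sub>E l\<in>UNIV. coord_values U l)"
        by (rule image_eqI[rotated]) simp
    qed
    show "finite (vec_lambda ` (\<Pi>\<^sub>E l\<in>UNIV. coord_values U l))"
      using assms by (intro finite_imageI finite_PiE) (auto simp: coord_values_def)
  qed
  ultimately show ?thesis by (rule finite_subset)
qed

lemma S3_nonempty:
  fixes U :: "(real ^ 'd) set"
  assumes "U \<noteq> {}"
  shows "S3 U t \<noteq> {}"
proof -
  obtain T :: "'d set" where "card T = CARD('d) - t"
    using obtain_subset_with_card_n[of "CARD('d) - t" "UNIV :: 'd set"] by auto
  moreover obtain x where "x \<in> U" using assms by blast
  ultimately have "x \<in> S3 U t"
    by (auto simp: S3_def S3_set_def coord_values_def)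
  then show ?thesis by blast
qed

end

theory Submission
  imports Defs
begin

text \<open>
  Fix a multi-index and write \<open>c\<^sub>i\<close> for the points it selects. The weighted cost to the \<open>c\<^sub>i\<close>
  splits over coordinates and is minimised by a coordinatewise weighted median, whose coordinates
  may be taken among those of the \<open>c\<^sub>i\<close>. Replacing the coordinates in \<open>T\<close> of the median by those
  of a \<open>c\<^sub>i\<close>, drawn with probability \<open>\<lambda>\<^sub>i\<close>, at most doubles the expected cost of these coordinates by
  the triangle inequality. If \<open>T\<close> consists of the \<open>d - t\<close> cheapest coordinates, the total cost
  thus grows by a factor of at most \<open>1 + (d - t) / d\<close>.

  To pass to measures, disintegrate couplings of \<open>Q\<close> with the discrete measures: the mass
  of the \<open>i\<close>-th coupling on \<open>dy \<times> {x\<^sub>i\<^sub>l}\<close> has a density \<open>g\<^sub>i\<^sub>l\<close> with respect to \<open>Q\<close>, and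
  \<open>\<integral> (\<Prod>i. g\<^sub>i (j i)) dQ\<close> is a feasible tensor. Its cost is at most the factor above times the weighted
  cost of the couplings.
\<close>

section \<open>Weighted medians on the real line\<close>

text \<open>Moving \<open>z\<close> down to the nearest value \<open>a j\<close> below it saves
  \<open>z - a j\<close> per unit of weight on the left and costs as much per unit on the right, so
  a left side at least as heavy pays for the move.\<close>

lemma weighted_median_left:
  fixes a lam :: "'i \<Rightarrow> real"
  assumes "finite I" and "i\<^sub>0 \<in> I" "a i\<^sub>0 < z"
    and heavy: "(\<Sum>i\<in>{i\<in>I. a i \<ge> z}. lam i) \<le> (\<Sum>i\<in>{i\<in>I. a i < z}. lam i)"
  shows "\<exists>j\<in>I. (\<Sum>i\<in>I. lam i * \<bar>a j - a i\<bar>) \<le> (\<Sum>i\<in>I. lam i * \<bar>z - a i\<bar>)"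
proof -
  let ?L = "{i\<in>I. a i < z}" and ?R = "{i\<in>I. a i \<ge> z}"
  have "finite ?L" "?L \<noteq> {}" using assms by auto
  then obtain j where j: "j \<in> ?L" "\<And>i. i \<in> ?L \<Longrightarrow> a i \<le> a j"
    using ex_is_arg_min_if_finite[of ?L "\<lambda>i. - a i"] by (auto simp: is_arg_min_linorder)
  have split: "(\<Sum>i\<in>I. f i) = (\<Sum>i\<in>?L. f i) + (\<Sum>i\<in>?R. f i)" for f :: "'i \<Rightarrow> real"
    by (subst sum.union_disjoint[symmetric]) (use assms(1) in \<open>auto intro!: sum.cong\<close>)
  have L: "(\<Sum>i\<in>?L. lam i * \<bar>a j - a i\<bar>) = (\<Sum>i\<in>?L. lam i * \<bar>z - a i\<bar>) - (z - a j) * (\<Sum>i\<in>?L. lam i)"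
    unfolding sum_distrib_left sum_subtractf[symmetric]
    by (intro sum.cong refl) (use j in \<open>force simp: algebra_simps abs_if\<close>)
  have R: "(\<Sum>i\<in>?R. lam i * \<bar>a j - a i\<bar>) = (\<Sum>i\<in>?R. lam i * \<bar>z - a i\<bar>) + (z - a j) * (\<Sum>i\<in>?R. lam i)"
    unfolding sum_distrib_left sum.distrib[symmetric]
    by (intro sum.cong refl) (use j in \<open>force simp: algebra_simps abs_if\<close>)
  have "(z - a j) * (\<Sum>i\<in>?R. lam i) \<le> (z - a j) * (\<Sum>i\<in>?L. lam i)"
    using j heavy by (intro mult_left_mono) auto
  then have "(\<Sum>i\<in>I. lam i * \<bar>a j - a i\<bar>) \<le> (\<Sum>i\<in>I. lam i * \<bar>z - a i\<bar>)"
    unfolding split L R by linarith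
  then show ?thesis using j(1) by blast
qed

text \<open>If \<open>z\<close> is not itself a value, slide it to the nearest value on the heavier
  side, which is nonempty because the total weight is positive.\<close>

lemma weighted_median_step:
  fixes a lam :: "'i \<Rightarrow> real"
  assumes "finite I" and pos: "0 < (\<Sum>i\<in>I. lam i)"
  shows "\<exists>j\<in>I. (\<Sum>i\<in>I. lam i * \<bar>a j - a i\<bar>) \<le> (\<Sum>i\<in>I. lam i * \<bar>z - a i\<bar>)"
proof (cases "\<exists>i\<in>I. a i = z")
  case False
  let ?L = "{i\<in>I. a i < z}" and ?R = "{i\<in>I. a i > z}"
  have R: "{i\<in>I. a i \<ge> z} = ?R" and L: "{i\<in>I. a i \<le> z} = ?L" using False by force+
  have split: "(\<Sum>i\<in>I. lam i) = (\<Sum>i\<in>?L. lam i) + (\<Sum>i\<in>?R. lam i)"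
    by (subst sum.union_disjoint[symmetric]) (use assms(1) False in \<open>auto intro!: sum.cong\<close>)
  show ?thesis
  proof (cases "(\<Sum>i\<in>?R. lam i) \<le> (\<Sum>i\<in>?L. lam i)")
    case True
    then have "(\<Sum>i\<in>?L. lam i) > 0" using split pos by linarith
    then obtain i where "i \<in> ?L" by (metis (no_types, lifting) less_irrefl sum.neutral)
    then show ?thesis
      using weighted_median_left[of I i a z lam] assms True by (auto simp: R)
  next
    case False
    then have "(\<Sum>i\<in>?R. lam i) > 0" using split pos by linarith
    then obtain i where "i \<in> ?R" by (metis (no_types, lifting) less_irrefl sum.neutral)
    \<comment> \<open>Negating \<open>z\<close> and all values exchanges left and right.\<close>
    then have "\<exists>j\<in>I. (\<Sum>i\<in>I. lam i * \<bar>- a j - - a i\<bar>) \<le> (\<Sum>i\<in>I. lam i * \<bar>- z - - a i\<bar>)"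
      using assms False by (intro weighted_median_left[of I i]) (auto simp: L)
    then show ?thesis by (simp add: abs_minus_commute)
  qed
qed auto

text \<open>A best position among the finitely many values beats every \<open>z\<close>, since some
  value already does at least as well as \<open>z\<close>.\<close>

lemma weighted_median:
  fixes a lam :: "'i \<Rightarrow> real"
  assumes "finite I" "0 < (\<Sum>i\<in>I. lam i)"
  shows "\<exists>j\<in>I. \<forall>z. (\<Sum>i\<in>I. lam i * \<bar>a j - a i\<bar>) \<le> (\<Sum>i\<in>I. lam i * \<bar>z - a i\<bar>)"
proof -
  have "I \<noteq> {}" using assms(2) by auto
  then obtain j where j: "j \<in> I" "\<And>j'. j' \<in> I \<Longrightarrow>
      (\<Sum>i\<in>I. lam i * \<bar>a j - a i\<bar>) \<le> (\<Sum>i\<in>I. lam i * \<bar>a j' - a i\<bar>)"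
    using ex_is_arg_min_if_finite[of I "\<lambda>j. \<Sum>i\<in>I. lam i * \<bar>a j - a i\<bar>"] assms(1)
    by (auto simp: is_arg_min_linorder)
  have "(\<Sum>i\<in>I. lam i * \<bar>a j - a i\<bar>) \<le> (\<Sum>i\<in>I. lam i * \<bar>z - a i\<bar>)" for z
  proof -
    obtain j' where "j' \<in> I" "(\<Sum>i\<in>I. lam i * \<bar>a j' - a i\<bar>) \<le> (\<Sum>i\<in>I. lam i * \<bar>z - a i\<bar>)"
      using weighted_median_step[OF assms] by blast
    then show ?thesis using j(2)[of j'] by linarith
  qed
  then show ?thesis using j(1) by blast
qed

section \<open>Cheapest coordinates and averaging\<close>

text \<open>Discard a largest element \<open>t\<close> times. The largest of r elements is at least
  their mean, so at most (r - 1) / r of the sum remains; these fractions telescope to (card A - t) /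
  card A.\<close>

lemma subset_with_small_sum:
  fixes h :: "'a \<Rightarrow> real"
  assumes "finite A" "t \<le> card A"
  shows "\<exists>T\<subseteq>A. card T = card A - t \<and> real (card A) * sum h T \<le> (real (card A) - real t) * sum h A"
  using assms(2)
proof (induction t)
  case (Suc t)
  then obtain T where T: "T \<subseteq> A" "card T = card A - t"
    "real (card A) * sum h T \<le> (real (card A) - real t) * sum h A" by auto
  have fT: "finite T" "T \<noteq> {}" using T Suc assms(1) by (auto intro: finite_subset)
  obtain e where e: "e \<in> T" "\<And>l. l \<in> T \<Longrightarrow> h l \<le> h e"
    using fT ex_is_arg_min_if_finite[of T "\<lambda>i. - h i"] by (auto simp: is_arg_min_linorder)
  \<comment> \<open>The size of \<open>T\<close> before the removal. It is at least 1 because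
    \<open>Suc t \<le> card A\<close>, so it can be cancelled at the end.\<close>
  define r where "r = real (card A) - real t"
  have r: "r \<ge> 1" "real (card T) = r" using Suc.prems T(2) by (auto simp: r_def of_nat_diff)
  have "sum h T \<le> r * h e" using sum_bounded_above[of T h "h e"] e r by simp
  then have "r * sum h (T - {e}) \<le> (r - 1) * sum h T"
    using fT e by (simp add: sum_diff1 algebra_simps)
  then have "real (card A) * (r * sum h (T - {e})) \<le> (r - 1) * (real (card A) * sum h T)"
    using mult_left_mono[of "r * sum h (T - {e})" "(r - 1) * sum h T" "real (card A)"]
    by (simp add: mult.left_commute)
  also have "\<dots> \<le> (r - 1) * (r * sum h A)"
    using T(3) r by (intro mult_left_mono) (auto simp: r_def)
  finally have "r * (real (card A) * sum h (T - {e})) \<le> r * ((r - 1) * sum h A)"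
    by (simp add: mult.left_commute)
  then have "real (card A) * sum h (T - {e}) \<le> (r - 1) * sum h A"
    using r by simp
  then show ?case
    using T e fT by (intro exI[of _ "T - {e}"]) (auto simp: r_def algebra_simps)
qed (use assms in auto)

text \<open>Otherwise the mean would exceed \<open>b\<close>. This replaces a random candidate by a
  fixed one.\<close>

lemma weighted_mean_ge_some:
  fixes f lam :: "'i \<Rightarrow> real"
  assumes "finite I" "\<And>i. i \<in> I \<Longrightarrow> 0 \<le> lam i" "(\<Sum>i\<in>I. lam i) = 1" "(\<Sum>i\<in>I. lam i * f i) \<le> b"
  shows "\<exists>i\<in>I. f i \<le> b"
proof (rule ccontr)
  assume "\<not> ?thesis"
  then have gt: "b < f i" if "i \<in> I" for i using that by force
  \<comment> \<open>Strictness has to come from an index of nonzero weight.\<close>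
  obtain i where i: "i \<in> I" "lam i \<noteq> 0"
    using assms(3) by (metis sum.neutral zero_neq_one)
  have le: "lam i' * b \<le> lam i' * f i'" if "i' \<in> I" for i'
    using gt[OF that] assms(2)[OF that] by (intro mult_left_mono) simp_all
  have "lam i * b < lam i * f i"
    using gt[OF i(1)] assms(2)[OF i(1)] i(2) by simp
  then have "(\<Sum>i\<in>I. lam i * b) < (\<Sum>i\<in>I. lam i * f i)"
    using le i(1) assms(1) by (intro sum_strict_mono_ex1) blast+
  then show False using assms by (simp flip: sum_distrib_right)
qed

section \<open>Cost of a single multi-index\<close>

lemma multi_index_mem:
  "j \<in> multi_indices k m \<Longrightarrow> i \<in> {1..k} \<Longrightarrow> j i \<in> {1..m i}"
  unfolding multi_indices_def by (rule PiE_mem[of j "{1..k}" "\<lambda>i. {1..m i}"])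

lemma finite_support_union: "finite (support_union k m x)"
  by (simp add: support_union_def)

text \<open>The comparison is with every \<open>y\<close>, not only with an optimal point, so that
  it can later be integrated against an arbitrary measure.\<close>

lemma mmot_cost_S3_le:
  fixes x :: "nat \<Rightarrow> nat \<Rightarrow> real ^ 'd"
  assumes lam: "\<And>i. i \<in> {1..k} \<Longrightarrow> 0 \<le> lam i" and lam_sum: "(\<Sum>i\<in>{1..k}. lam i) = 1"
    and t: "t \<le> CARD('d)" and j: "j \<in> multi_indices k m"
  shows "mmot_cost k lam x (S3 (support_union k m x) t) j
    \<le> (1 + (real CARD('d) - real t) / real CARD('d)) * (\<Sum>i\<in>{1..k}. lam i * norm1 (y - x i (j i)))"
proof -
  let ?U = "support_union k m x" and ?I = "{1..k}"
  define c where "c i = x i (j i)" for i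
  define f where "f l z = (\<Sum>i\<in>?I. lam i * \<bar>z - c i $ l\<bar>)" for l z
  have cU: "c i \<in> ?U" if "i \<in> ?I" for i
    using that multi_index_mem[OF j that] unfolding support_union_def c_def by blast
  have "\<exists>i\<in>?I. \<forall>z. f l (c i $ l) \<le> f l z" for l
    unfolding f_def by (rule weighted_median) (use lam lam_sum in auto)
  then obtain med where med: "med l \<in> ?I" "f l (c (med l) $ l) \<le> f l z" for l z by metis
  define h where "h l = f l (c (med l) $ l)" for l
  \<comment> \<open>The cost separates into one-dimensional costs \<open>f l\<close>, each with
    minimum \<open>h l\<close>.\<close>
  have cost: "(\<Sum>i\<in>?I. lam i * norm1 (w - c i)) = (\<Sum>l\<in>UNIV. f l (w $ l))" for w
    unfolding norm1_def f_def by (subst sum.swap) (simp add: sum_distrib_left)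
  obtain T :: "'d set" where T: "card T = CARD('d) - t"
    "real CARD('d) * sum h T \<le> (real CARD('d) - real t) * sum h UNIV"
    using subset_with_small_sum[of "UNIV :: 'd set" t h] t by auto
  \<comment> \<open>The random candidate. On \<open>T\<close> it copies \<open>c i\<close>, the
    witness that \<open>S3_set\<close> asks for; elsewhere each median coordinate is a coordinate of
    some point of \<open>?U\<close>.\<close>
  define w where "w i = (\<chi> l. if l \<in> T then c i $ l else c (med l) $ l)" for i
  have wS: "w i \<in> S3 ?U t" if "i \<in> ?I" for i
    using T(1) cU[OF that] cU[OF med(1)]
    by (auto simp: S3_def S3_set_def coord_values_def w_def intro!: exI[of _ T])
  \<comment> \<open>Draw two indices independently with weights \<open>lam\<close>: the triangle
    inequality through the median bounds their expected distance by twice the expected distance to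
    the median.\<close>
  have pairs: "(\<Sum>i\<in>?I. lam i * f l (c i $ l)) \<le> 2 * h l" for l
  proof -
    have "(\<Sum>i\<in>?I. lam i * f l (c i $ l))
        \<le> (\<Sum>i\<in>?I. \<Sum>i'\<in>?I. lam i * lam i' * (\<bar>c (med l) $ l - c i $ l\<bar> + \<bar>c (med l) $ l - c i' $ l\<bar>))"
      unfolding f_def sum_distrib_left mult.assoc[symmetric]
      by (intro sum_mono mult_left_mono) (auto simp: lam)
    also have "\<dots> = (\<Sum>i\<in>?I. lam i * \<bar>c (med l) $ l - c i $ l\<bar>) * (\<Sum>i\<in>?I. lam i)
        + (\<Sum>i\<in>?I. lam i) * (\<Sum>i\<in>?I. lam i * \<bar>c (med l) $ l - c i $ l\<bar>)"
      unfolding sum_product sum.distrib[symmetric]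
      by (intro sum.cong refl) (simp add: algebra_simps)
    also have "\<dots> = 2 * h l" using lam_sum by (simp add: h_def f_def)
    finally show ?thesis .
  qed
  have "(\<Sum>i\<in>?I. lam i * (\<Sum>l\<in>UNIV. f l (w i $ l)))
      = (\<Sum>l\<in>UNIV. \<Sum>i\<in>?I. lam i * f l (w i $ l))"
    by (subst sum.swap) (simp add: sum_distrib_left)
  \<comment> \<open>Off \<open>T\<close> every candidate pays exactly \<open>h l\<close>; on
    \<open>T\<close> the mean is at most \<open>2 * h l\<close>.\<close>
  also have "\<dots> \<le> (\<Sum>l\<in>UNIV. h l + (if l \<in> T then h l else 0))"
    using pairs by (intro sum_mono) (use lam_sum in \<open>auto simp: w_def h_def simp flip: sum_distrib_right\<close>)
  also have "\<dots> = sum h UNIV + sum h T"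
    by (simp add: sum.distrib flip: sum.inter_restrict sum.inter_filter)
  also have "\<dots> \<le> (1 + (real CARD('d) - real t) / real CARD('d)) * sum h UNIV"
    using T(2) by (simp add: field_simps)
  finally obtain i where i: "i \<in> ?I" "(\<Sum>l\<in>UNIV. f l (w i $ l))
      \<le> (1 + (real CARD('d) - real t) / real CARD('d)) * sum h UNIV"
    using weighted_mean_ge_some[of ?I lam] lam lam_sum by fast
  have "mmot_cost k lam x (S3 ?U t) j \<le> (\<Sum>i'\<in>?I. lam i' * norm1 (w i - c i'))"
    unfolding mmot_cost_def c_def[symmetric] using wS[OF i(1)]
    by (intro Min_le) (auto simp: finite_S3 finite_support_union)
  also have "\<dots> \<le> (1 + (real CARD('d) - real t) / real CARD('d)) * sum h UNIV"
    unfolding cost by (rule i(2))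
  \<comment> \<open>Each \<open>h l\<close> is at most \<open>f l (y $ l)\<close> by minimality, and
    \<open>t\<close> not exceeding the dimension keeps the factor nonnegative.\<close>
  also have "\<dots> \<le> (1 + (real CARD('d) - real t) / real CARD('d))
      * (\<Sum>i\<in>?I. lam i * norm1 (y - c i))"
    unfolding cost h_def using t by (intro mult_left_mono sum_mono med(2)) auto
  finally show ?thesis by (simp add: c_def)
qed

section \<open>Disintegration of a coupling with a discrete measure\<close>

text \<open>\<open>g l y\<close> is the conditional probability that the second component is
  \<open>x l\<close> when the first is \<open>y\<close>, obtained as a Radon-Nikodym derivative.
  Injectivity identifies indices with atoms.\<close>

lemma discrete_coupling_densities:
  fixes x :: "nat \<Rightarrow> real ^ 'd"
  assumes Q: "prob_space Q" "sets Q = sets borel"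
    and \<pi>: "\<pi> \<in> couplings Q (discrete_measure m p x)"
    and inj: "inj_on x {1..m}"
  obtains g :: "nat \<Rightarrow> real ^ 'd \<Rightarrow> ennreal" where
    "\<And>l. g l \<in> borel_measurable Q"
    "AE y in Q. (\<Sum>l\<in>{1..m}. g l y) = 1"
    "\<And>l. l \<in> {1..m} \<Longrightarrow> (\<integral>\<^sup>+ y. g l y \<partial>Q) = ennreal (p l)"
    "(\<Sum>l\<in>{1..m}. \<integral>\<^sup>+ y. ennreal (norm1 (y - x l)) * g l y \<partial>Q)
      \<le> (\<integral>\<^sup>+ z. ennreal (norm1 (fst z - snd z)) \<partial>\<pi>)"
proof -
  interpret Q: prob_space Q by fact
  have s\<pi> [measurable_cong]: "sets \<pi> = sets (borel \<Otimes>\<^sub>M borel)"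
    and f: "distr \<pi> borel fst = Q" and s: "distr \<pi> borel snd = discrete_measure m p x"
    using \<pi> by (auto simp: couplings_def)
  note Q(2)[measurable_cong]
  \<comment> \<open>\<open>I l\<close> cuts out the slice with second component \<open>x l\<close>;
    \<open>\<nu> l\<close> is the first marginal of that slice.\<close>
  define I where "I l z = (indicator {x l} (snd z) :: ennreal)" for l and z :: "(real^'d) \<times> (real^'d)"
  have I [measurable]: "I l \<in> borel_measurable \<pi>" for l unfolding I_def by measurable
  define \<nu> where "\<nu> l = distr (density \<pi> (I l)) borel fst" for l
  have nn\<nu>: "(\<integral>\<^sup>+ y. h y \<partial>\<nu> l) = (\<integral>\<^sup>+ z. I l z * h (fst z) \<partial>\<pi>)"
    if [measurable]: "h \<in> borel_measurable borel" for h l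
    unfolding \<nu>_def by (subst nn_integral_distr) (auto simp: nn_integral_density)
  have nnQ: "(\<integral>\<^sup>+ y. h y \<partial>Q) = (\<integral>\<^sup>+ z. h (fst z) \<partial>\<pi>)"
    if [measurable]: "h \<in> borel_measurable borel" for h
    by (subst f[symmetric], subst nn_integral_distr) auto
  have "\<exists>g. g \<in> borel_measurable Q \<and> density Q g = \<nu> l" for l
  proof -
    \<comment> \<open>A slice of \<pi> carries at most the mass of \<pi>, so \<open>\<nu> l\<close>
      is dominated by the first marginal \<open>Q\<close>.\<close>
    have "absolutely_continuous Q (\<nu> l)"
    proof (unfold absolutely_continuous_def, rule subsetI)
      fix A assume A: "A \<in> null_sets Q"
      then have A': "A \<in> sets borel" "emeasure Q A = 0" using Q(2) by auto
      then have "(\<integral>\<^sup>+ y. indicator A y \<partial>Q) = 0" using Q(2) by simp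
      moreover
      have "(\<integral>\<^sup>+ y. indicator A y \<partial>\<nu> l) \<le> (\<integral>\<^sup>+ y. indicator A y \<partial>Q)"
        using A' by (subst nn\<nu>, simp, subst nnQ, simp)
          (intro nn_integral_mono, auto simp: I_def indicator_def)
      moreover have "sets (\<nu> l) = sets borel" by (simp add: \<nu>_def)
      ultimately show "A \<in> null_sets (\<nu> l)"
        using A'(1) by (intro null_setsI) auto
    qed
    then show ?thesis
      using Q.Radon_Nikodym[of "\<nu> l"] Q(2) by (auto simp: \<nu>_def)
  qed
  then obtain g where g [measurable]: "\<And>l. g l \<in> borel_measurable Q"
    and dg: "\<And>l. density Q (g l) = \<nu> l" by metis
  \<comment> \<open>The three remaining claims are instances of this formula: for indicators, the
    constant 1, and the distance to \<open>x l\<close>.\<close>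
  have nng: "(\<integral>\<^sup>+ y. h y * g l y \<partial>Q) = (\<integral>\<^sup>+ z. I l z * h (fst z) \<partial>\<pi>)"
    if [measurable]: "h \<in> borel_measurable borel" for h l
    by (subst nn\<nu>[symmetric], simp, subst dg[symmetric], subst nn_integral_density)
      (auto simp: mult.commute)
  define X where "X = x ` {1..m}"
  have X: "closed X" unfolding X_def by (intro finite_imp_closed) simp
  have "AE y in discrete_measure m p x. y \<in> X"
  proof (rule AE_I[of _ _ "- X"])
    show "emeasure (discrete_measure m p x) (- X) = 0"
      using X by (subst emeasure_discrete_measure) (auto simp: X_def intro: borel_open)
    show "- X \<in> sets (discrete_measure m p x)"
      using X by (simp add: discrete_measure_def borel_open open_Compl)
  qed auto
  then have supp: "AE z in \<pi>. snd z \<in> X"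
    unfolding s[symmetric] using X by (subst (asm) AE_distr_iff) (auto intro: borel_closed)
  \<comment> \<open>Injectivity makes the slices disjoint, so exactly one indicator is 1.\<close>
  have sum_I: "(\<Sum>l\<in>{1..m}. I l z) = 1" if z: "snd z \<in> X" for z
  proof -
    obtain l where l: "l \<in> {1..m}" "snd z = x l" using z by (auto simp: X_def)
    have "I l' z = (if l' = l then 1 else 0)" if "l' \<in> {1..m}" for l'
      using inj_on_eq_iff[OF inj l(1) that] l(2) by (auto simp: I_def indicator_def)
    then have "(\<Sum>l'\<in>{1..m}. I l' z) = (\<Sum>l'\<in>{1..m}. if l' = l then 1 else 0)"
      by (intro sum.cong refl)
    then show ?thesis using l(1) by simp
  qed
  have sum_AE: "AE z in \<pi>. (\<Sum>l\<in>{1..m}. I l z) = 1"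
    using supp by eventually_elim (rule sum_I)
  have AE1: "AE y in Q. (\<Sum>l\<in>{1..m}. g l y) = 1"
  proof -
    \<comment> \<open>Both densities reproduce \<open>Q\<close>, and densities are unique almost
      everywhere.\<close>
    have "density Q (\<lambda>y. \<Sum>l\<in>{1..m}. g l y) = density Q (\<lambda>_. 1)"
    proof (rule measure_eqI)
      fix A assume "A \<in> sets (density Q (\<lambda>y. \<Sum>l\<in>{1..m}. g l y))"
      then have A [measurable]: "A \<in> sets borel" using Q(2) by simp
      have "emeasure (density Q (\<lambda>y. \<Sum>l\<in>{1..m}. g l y)) A
          = (\<integral>\<^sup>+ y. (\<Sum>l\<in>{1..m}. indicator A y * g l y) \<partial>Q)"
        using Q(2) by (subst emeasure_density) (auto simp: sum_distrib_left mult.commute)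
      also have "\<dots> = (\<Sum>l\<in>{1..m}. \<integral>\<^sup>+ y. indicator A y * g l y \<partial>Q)"
        by (rule nn_integral_sum) measurable
      also have "\<dots> = (\<Sum>l\<in>{1..m}. \<integral>\<^sup>+ z. I l z * indicator A (fst z) \<partial>\<pi>)"
        by (intro sum.cong refl nng) measurable
      also have "\<dots> = (\<integral>\<^sup>+ z. (\<Sum>l\<in>{1..m}. I l z * indicator A (fst z)) \<partial>\<pi>)"
        by (rule nn_integral_sum[symmetric]) measurable
      also have "\<dots> = (\<integral>\<^sup>+ z. indicator A (fst z) \<partial>\<pi>)"
        by (rule nn_integral_cong_AE, use sum_AE in eventually_elim) (simp flip: sum_distrib_right)
      also have "\<dots> = emeasure (density Q (\<lambda>_. 1)) A"
        using Q(2) by (subst nnQ[symmetric]) (auto simp: emeasure_density)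
      finally show "emeasure (density Q (\<lambda>y. \<Sum>l\<in>{1..m}. g l y)) A = emeasure (density Q (\<lambda>_. 1)) A" .
    qed simp
    then show ?thesis
      by (subst (asm) Q.density_unique_iff) auto
  qed
  have marg: "(\<integral>\<^sup>+ y. g l y \<partial>Q) = ennreal (p l)" if l: "l \<in> {1..m}" for l
  proof -
    have "(\<integral>\<^sup>+ y. g l y \<partial>Q) = (\<integral>\<^sup>+ z. indicator {x l} (snd z) \<partial>\<pi>)"
      using nng[of "\<lambda>_. 1" l] by (simp add: I_def)
    also have "\<dots> = (\<integral>\<^sup>+ y. indicator {x l} y \<partial>distr \<pi> borel snd)"
      by (subst nn_integral_distr) auto
    also have "\<dots> = emeasure (discrete_measure m p x) {x l}"
      unfolding s by (rule nn_integral_indicator) (simp add: discrete_measure_def)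
    also have "\<dots> = (\<Sum>j\<in>{1..m}. ennreal (p j) * indicator {x l} (x j))"
      by (intro emeasure_discrete_measure) simp
    also have "\<dots> = (\<Sum>j\<in>{1..m}. if j = l then ennreal (p l) else 0)"
    proof (intro sum.cong refl)
      fix j assume "j \<in> {1..m}"
      then show "ennreal (p j) * indicator {x l} (x j) = (if j = l then ennreal (p l) else 0)"
        using inj_on_eq_iff[OF inj _ l, of j] by (auto simp: indicator_def)
    qed
    finally show ?thesis using l by simp
  qed
  have "(\<Sum>l\<in>{1..m}. \<integral>\<^sup>+ y. ennreal (norm1 (y - x l)) * g l y \<partial>Q)
      = (\<Sum>l\<in>{1..m}. \<integral>\<^sup>+ z. I l z * ennreal (norm1 (fst z - x l)) \<partial>\<pi>)"
    by (intro sum.cong refl nng) measurable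
  also have "\<dots> = (\<integral>\<^sup>+ z. (\<Sum>l\<in>{1..m}. I l z * ennreal (norm1 (fst z - x l))) \<partial>\<pi>)"
    by (rule nn_integral_sum[symmetric]) measurable
  \<comment> \<open>On slice \<open>l\<close> the point \<open>x l\<close> is
    \<open>snd z\<close>.\<close>
  also have "\<dots> = (\<integral>\<^sup>+ z. (\<Sum>l\<in>{1..m}. I l z * ennreal (norm1 (fst z - snd z))) \<partial>\<pi>)"
    by (intro nn_integral_cong sum.cong refl) (auto simp: I_def indicator_def)
  also have "\<dots> = (\<integral>\<^sup>+ z. ennreal (norm1 (fst z - snd z)) \<partial>\<pi>)"
    by (rule nn_integral_cong_AE, use sum_AE in eventually_elim) (simp flip: sum_distrib_right)
  finally show ?thesis using that[of g] g AE1 marg by simp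
qed

section \<open>Sums over multi-indices\<close>

lemma finite_multi_indices: "finite (multi_indices k m)"
  unfolding multi_indices_def by (intro finite_PiE) auto

text \<open>Fixing one entry leaves a product set, so distributivity gives a product of sums in
  which every factor but the \<open>i\<close>-th is 1.\<close>

lemma sum_multi_indices_prod_fix:
  fixes g :: "nat \<Rightarrow> nat \<Rightarrow> 'a::comm_semiring_1"
  assumes i: "i \<in> {1..k}" and l: "l \<in> {1..m i}"
    and g: "\<And>i. i \<in> {1..k} \<Longrightarrow> (\<Sum>l\<in>{1..m i}. g i l) = 1"
  shows "(\<Sum>j\<in>{j \<in> multi_indices k m. j i = l}. \<Prod>i\<in>{1..k}. g i (j i)) = g i l"
proof -
  have e: "{j \<in> multi_indices k m. j i = l} = (\<Pi>\<^sub>E i'\<in>{1..k}. if i' = i then {l} else {1..m i'})"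
  proof (intro set_eqI iffI)
    fix j assume j: "j \<in> (\<Pi>\<^sub>E i'\<in>{1..k}. if i' = i then {l} else {1..m i'})"
    have "j i = l" using PiE_mem[OF j i] by simp
    moreover have "j i' \<in> {1..m i'}" if "i' \<in> {1..k}" for i'
      using PiE_mem[OF j that] l by (cases "i' = i") simp_all
    then have "j \<in> multi_indices k m"
      using j unfolding multi_indices_def PiE_iff by blast
    ultimately show "j \<in> {j \<in> multi_indices k m. j i = l}" by simp
  qed (simp add: multi_indices_def PiE_iff)
  have "(\<Sum>j\<in>{j \<in> multi_indices k m. j i = l}. \<Prod>i\<in>{1..k}. g i (j i))
      = (\<Prod>i'\<in>{1..k}. \<Sum>l'\<in>(if i' = i then {l} else {1..m i'}). g i' l')"
    unfolding e by (rule prod_sum_PiE[symmetric]) auto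
  also have "\<dots> = (\<Prod>i'\<in>{1..k}. if i' = i then g i l else 1)"
    by (intro prod.cong refl) (use g in auto)
  finally show ?thesis using i by simp
qed

text \<open>Grouping by the entry \<open>j i\<close> shows that a cost depending on one entry sees
  only the corresponding marginal.\<close>

lemma sum_multi_indices_marginal:
  fixes f :: "nat \<Rightarrow> 'a::comm_semiring_1" and P :: "(nat \<Rightarrow> nat) \<Rightarrow> 'a"
  assumes i: "i \<in> {1..k}"
  shows "(\<Sum>j\<in>multi_indices k m. f (j i) * P j)
    = (\<Sum>l\<in>{1..m i}. f l * (\<Sum>j\<in>{j \<in> multi_indices k m. j i = l}. P j))"
proof -
  have "(\<Sum>j\<in>multi_indices k m. f (j i) * P j)
      = (\<Sum>l\<in>{1..m i}. \<Sum>j\<in>{j \<in> multi_indices k m. j i = l}. f (j i) * P j)"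
    using multi_index_mem[OF _ i]
    by (intro sum.group[symmetric] finite_multi_indices) (auto simp del: atLeastAtMost_iff)
  then show ?thesis by (simp add: sum_distrib_left)
qed

section \<open>Gluing couplings into a feasible tensor\<close>

text \<open>The couplings share the first marginal \<open>Q\<close> and are glued along it: given
  \<open>y\<close>, the indices are drawn independently with probabilities
  \<open>g i l y\<close>.\<close>

lemma mmot_value_le_couplings:
  fixes x :: "nat \<Rightarrow> nat \<Rightarrow> real ^ 'd"
  assumes lam: "\<And>i. i \<in> {1..k} \<Longrightarrow> 0 \<le> lam i"
    and S: "finite S" "S \<noteq> {}"
    and p: "\<And>i j. i \<in> {1..k} \<Longrightarrow> j \<in> {1..m i} \<Longrightarrow> 0 \<le> p i j"
    and inj: "\<And>i. i \<in> {1..k} \<Longrightarrow> inj_on (x i) {1..m i}"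
    and Q: "prob_space Q" "sets Q = sets borel"
    and \<pi>: "\<And>i. i \<in> {1..k} \<Longrightarrow> \<pi> i \<in> couplings Q (discrete_measure (m i) (p i) (x i))"
    and k: "1 \<le> k" and c: "0 \<le> c"
    and cost: "\<And>j y. j \<in> multi_indices k m \<Longrightarrow>
      mmot_cost k lam x S j \<le> c * (\<Sum>i\<in>{1..k}. lam i * norm1 (y - x i (j i)))"
  shows "ennreal (mmot_value k lam m p x S)
    \<le> ennreal c * (\<Sum>i\<in>{1..k}. ennreal (lam i) * (\<integral>\<^sup>+ z. ennreal (norm1 (fst z - snd z)) \<partial>\<pi> i))"
proof -
  let ?J = "multi_indices k m"
  define R where "R i g \<longleftrightarrow> (\<forall>l. g l \<in> borel_measurable Q)
    \<and> (AE y in Q. (\<Sum>l\<in>{1..m i}. g l y) = 1)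
    \<and> (\<forall>l\<in>{1..m i}. (\<integral>\<^sup>+ y. g l y \<partial>Q) = ennreal (p i l))
    \<and> (\<Sum>l\<in>{1..m i}. \<integral>\<^sup>+ y. ennreal (norm1 (y - x i l)) * g l y \<partial>Q)
      \<le> (\<integral>\<^sup>+ z. ennreal (norm1 (fst z - snd z)) \<partial>\<pi> i)" for i g
  have "\<exists>g. R i g" if i: "i \<in> {1..k}" for i
    unfolding R_def by (rule discrete_coupling_densities[OF Q \<pi>[OF i] inj[OF i]]) blast
  then obtain g where R: "\<And>i. i \<in> {1..k} \<Longrightarrow> R i (g i)" by metis
  have g: "\<And>i l. i \<in> {1..k} \<Longrightarrow> g i l \<in> borel_measurable Q"
    and g1: "\<And>i. i \<in> {1..k} \<Longrightarrow> AE y in Q. (\<Sum>l\<in>{1..m i}. g i l y) = 1"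
    and gp: "\<And>i l. i \<in> {1..k} \<Longrightarrow> l \<in> {1..m i} \<Longrightarrow> (\<integral>\<^sup>+ y. g i l y \<partial>Q) = ennreal (p i l)"
    and gc: "\<And>i. i \<in> {1..k} \<Longrightarrow> (\<Sum>l\<in>{1..m i}. \<integral>\<^sup>+ y. ennreal (norm1 (y - x i l)) * g i l y \<partial>Q)
      \<le> (\<integral>\<^sup>+ z. ennreal (norm1 (fst z - snd z)) \<partial>\<pi> i)"
    using R unfolding R_def by blast+
  note Q(2)[measurable_cong] g[measurable]
  \<comment> \<open>The conditional probability of the multi-index \<open>j\<close> given
    \<open>y\<close>; its integral \<open>E j\<close> becomes the tensor entry.\<close>
  define G where "G j y = (\<Prod>i\<in>{1..k}. g i (j i) y)" for j y
  have G [measurable]: "G j \<in> borel_measurable Q" for j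
    unfolding G_def by measurable
  have AE_all: "AE y in Q. \<forall>i\<in>{1..k}. (\<Sum>l\<in>{1..m i}. g i l y) = 1"
    using g1 by (intro AE_finite_allI) auto
  have Gmarg: "AE y in Q. \<forall>i\<in>{1..k}. \<forall>l\<in>{1..m i}. (\<Sum>j\<in>{j \<in> ?J. j i = l}. G j y) = g i l y"
    using AE_all
  proof eventually_elim
    case (elim y)
    then show ?case
      unfolding G_def using sum_multi_indices_prod_fix[of _ k _ m "\<lambda>i l. g i l y"] by blast
  qed
  define E where "E j = (\<integral>\<^sup>+ y. G j y \<partial>Q)" for j
  have Emarg: "(\<Sum>j\<in>{j \<in> ?J. j i = l}. E j) = ennreal (p i l)"
    if i: "i \<in> {1..k}" and l: "l \<in> {1..m i}" for i l
  proof -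
    have "(\<Sum>j\<in>{j \<in> ?J. j i = l}. E j) = (\<integral>\<^sup>+ y. (\<Sum>j\<in>{j \<in> ?J. j i = l}. G j y) \<partial>Q)"
      unfolding E_def by (rule nn_integral_sum[symmetric]) measurable
    also have "\<dots> = (\<integral>\<^sup>+ y. g i l y \<partial>Q)"
      using Gmarg i l by (intro nn_integral_cong_AE) auto
    finally show ?thesis using gp[OF i l] by simp
  qed
  \<comment> \<open>An entry is one term of a finite marginal sum, so passing to reals loses
    nothing; index 1 exists because \<open>k\<close> is positive.\<close>
  have Efin: "E j < top" if j: "j \<in> ?J" for j
  proof -
    have 1: "1 \<in> {1..k}" using k by simp
    have "E j \<le> (\<Sum>j'\<in>{j' \<in> ?J. j' 1 = j 1}. E j')"
      using j finite_multi_indices[of k m] by (intro member_le_sum) auto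
    also have "\<dots> = ennreal (p 1 (j 1))"
      using multi_index_mem[OF j 1] by (intro Emarg[OF 1])
    finally show ?thesis by (simp add: order_le_less_trans)
  qed
  define \<rho> where "\<rho> j = enn2real (E j)" for j
  have E\<rho>: "ennreal (\<rho> j) = E j" if "j \<in> ?J" for j
    using Efin[OF that] by (simp add: \<rho>_def)
  have \<rho>0: "0 \<le> \<rho> j" for j by (simp add: \<rho>_def)
  have feas: "\<rho> \<in> mmot_feasible k m p"
  proof -
    have "(\<Sum>j\<in>{j \<in> ?J. j i = l}. \<rho> j) = p i l" if i: "i \<in> {1..k}" and l: "l \<in> {1..m i}" for i l
    proof -
      have "ennreal (\<Sum>j\<in>{j \<in> ?J. j i = l}. \<rho> j) = (\<Sum>j\<in>{j \<in> ?J. j i = l}. E j)"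
        by (subst sum_ennreal[symmetric]) (auto simp: \<rho>0 E\<rho>)
      then show ?thesis
        using Emarg[OF i l] p[OF i l] by (simp add: sum_nonneg \<rho>0)
    qed
    then show ?thesis unfolding mmot_feasible_def using \<rho>0 by blast
  qed
  \<comment> \<open>Nonnegative costs bound the objective values below, as the real infimum
    requires.\<close>
  have cost0: "0 \<le> mmot_cost k lam x S j" for j
    unfolding mmot_cost_def using S lam
    by (intro Min.boundedI) (auto intro!: sum_nonneg mult_nonneg_nonneg norm1_nonneg)
  have "mmot_value k lam m p x S \<le> (\<Sum>j\<in>?J. mmot_cost k lam x S j * \<rho> j)"
    unfolding mmot_value_def
  proof (rule cINF_lower[OF _ feas])
    show "bdd_below ((\<lambda>\<pi>. \<Sum>j\<in>?J. mmot_cost k lam x S j * \<pi> j) ` mmot_feasible k m p)"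
      using cost0 by (intro bdd_belowI2[of _ 0] sum_nonneg mult_nonneg_nonneg) (auto simp: mmot_feasible_def)
  qed
  then have "ennreal (mmot_value k lam m p x S) \<le> ennreal (\<Sum>j\<in>?J. mmot_cost k lam x S j * \<rho> j)"
    by (rule ennreal_leI)
  also have "\<dots> = (\<Sum>j\<in>?J. ennreal (mmot_cost k lam x S j) * E j)"
    by (subst sum_ennreal[symmetric]) (auto simp: cost0 \<rho>0 ennreal_mult E\<rho> intro!: sum.cong)
  also have "\<dots> = (\<integral>\<^sup>+ y. (\<Sum>j\<in>?J. ennreal (mmot_cost k lam x S j) * G j y) \<partial>Q)"
    unfolding E_def by (subst nn_integral_sum) (auto simp: nn_integral_cmult)
  also have "\<dots> \<le> (\<integral>\<^sup>+ y. ennreal c * (\<Sum>i\<in>{1..k}. ennreal (lam i) *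
      (\<Sum>l\<in>{1..m i}. ennreal (norm1 (y - x i l)) * g i l y)) \<partial>Q)"
  \<comment> \<open>The integration variable itself serves as the comparison point \<open>y\<close>
    in \<open>cost\<close>.\<close>
  proof (rule nn_integral_mono_AE, use Gmarg in eventually_elim)
    fix y assume y: "\<forall>i\<in>{1..k}. \<forall>l\<in>{1..m i}. (\<Sum>j\<in>{j \<in> ?J. j i = l}. G j y) = g i l y"
    have "(\<Sum>j\<in>?J. ennreal (mmot_cost k lam x S j) * G j y)
        \<le> (\<Sum>j\<in>?J. (ennreal c * (\<Sum>i\<in>{1..k}. ennreal (lam i) * ennreal (norm1 (y - x i (j i))))) * G j y)"
    proof (intro sum_mono mult_right_mono)
      fix j assume "j \<in> ?J"
      have "ennreal (\<Sum>i\<in>{1..k}. lam i * norm1 (y - x i (j i)))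
          = (\<Sum>i\<in>{1..k}. ennreal (lam i * norm1 (y - x i (j i))))"
        using lam by (intro sum_ennreal[symmetric]) (auto simp: norm1_nonneg)
      also have "\<dots> = (\<Sum>i\<in>{1..k}. ennreal (lam i) * ennreal (norm1 (y - x i (j i))))"
        using lam by (intro sum.cong refl ennreal_mult) (auto simp: norm1_nonneg)
      finally show "ennreal (mmot_cost k lam x S j)
          \<le> ennreal c * (\<Sum>i\<in>{1..k}. ennreal (lam i) * ennreal (norm1 (y - x i (j i))))"
        using ennreal_leI[OF cost[OF \<open>j \<in> ?J\<close>, of y]] c by (simp add: ennreal_mult')
    qed simp
    \<comment> \<open>With \<open>i\<close> outermost the distance depends only on
      \<open>j i\<close>, so \<open>G\<close> can be summed down to its marginal
      \<open>g i l y\<close>.\<close>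
    also have "\<dots> = ennreal c * (\<Sum>i\<in>{1..k}. ennreal (lam i) *
        (\<Sum>j\<in>?J. ennreal (norm1 (y - x i (j i))) * G j y))"
      unfolding sum_distrib_left sum_distrib_right by (subst sum.swap) (simp add: mult.assoc)
    also have "\<dots> = ennreal c * (\<Sum>i\<in>{1..k}. ennreal (lam i) *
        (\<Sum>l\<in>{1..m i}. ennreal (norm1 (y - x i l)) * g i l y))"
    proof (intro arg_cong2[where f="(*)"] sum.cong refl)
      fix i assume i: "i \<in> {1..k}"
      show "(\<Sum>j\<in>?J. ennreal (norm1 (y - x i (j i))) * G j y)
          = (\<Sum>l\<in>{1..m i}. ennreal (norm1 (y - x i l)) * g i l y)"
        using y i by (subst sum_multi_indices_marginal[OF i, of "\<lambda>l. ennreal (norm1 (y - x i l))"])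
          (auto intro!: sum.cong)
    qed
    finally show "(\<Sum>j\<in>?J. ennreal (mmot_cost k lam x S j) * G j y)
        \<le> ennreal c * (\<Sum>i\<in>{1..k}. ennreal (lam i) *
          (\<Sum>l\<in>{1..m i}. ennreal (norm1 (y - x i l)) * g i l y))" .
  qed
  also have "\<dots> = ennreal c * (\<Sum>i\<in>{1..k}. ennreal (lam i) *
      (\<Sum>l\<in>{1..m i}. \<integral>\<^sup>+ y. ennreal (norm1 (y - x i l)) * g i l y \<partial>Q))"
  proof -
    let ?h = "\<lambda>i l y. ennreal (norm1 (y - x i l)) * g i l y"
    have M: "?h i l \<in> borel_measurable Q" if "i \<in> {1..k}" for i l
      using g[OF that] by measurable
    have N: "(\<lambda>y. ennreal (lam i) * (\<Sum>l\<in>{1..m i}. ?h i l y)) \<in> borel_measurable Q"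
      if "i \<in> {1..k}" for i
      using M[OF that] by measurable
    have "(\<integral>\<^sup>+ y. ennreal c * (\<Sum>i\<in>{1..k}. ennreal (lam i) * (\<Sum>l\<in>{1..m i}. ?h i l y)) \<partial>Q)
        = ennreal c * (\<integral>\<^sup>+ y. (\<Sum>i\<in>{1..k}. ennreal (lam i) * (\<Sum>l\<in>{1..m i}. ?h i l y)) \<partial>Q)"
      by (intro nn_integral_cmult borel_measurable_sum N)
    also have "\<dots> = ennreal c * (\<Sum>i\<in>{1..k}. \<integral>\<^sup>+ y. ennreal (lam i) * (\<Sum>l\<in>{1..m i}. ?h i l y) \<partial>Q)"
      by (intro arg_cong2[where f="(*)"] refl nn_integral_sum N)
    also have "\<dots> = ennreal c * (\<Sum>i\<in>{1..k}. ennreal (lam i) * (\<Sum>l\<in>{1..m i}. \<integral>\<^sup>+ y. ?h i l y \<partial>Q))"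
    proof (intro arg_cong2[where f="(*)"] sum.cong refl)
      fix i assume i: "i \<in> {1..k}"
      have "(\<integral>\<^sup>+ y. ennreal (lam i) * (\<Sum>l\<in>{1..m i}. ?h i l y) \<partial>Q)
          = ennreal (lam i) * (\<integral>\<^sup>+ y. (\<Sum>l\<in>{1..m i}. ?h i l y) \<partial>Q)"
        by (intro nn_integral_cmult borel_measurable_sum M[OF i])
      also have "\<dots> = ennreal (lam i) * (\<Sum>l\<in>{1..m i}. \<integral>\<^sup>+ y. ?h i l y \<partial>Q)"
        by (intro arg_cong2[where f="(*)"] refl nn_integral_sum M[OF i])
      finally show "(\<integral>\<^sup>+ y. ennreal (lam i) * (\<Sum>l\<in>{1..m i}. ?h i l y) \<partial>Q)
          = ennreal (lam i) * (\<Sum>l\<in>{1..m i}. \<integral>\<^sup>+ y. ?h i l y \<partial>Q)" .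
    qed
    finally show ?thesis .
  qed
  also have "\<dots> \<le> ennreal c * (\<Sum>i\<in>{1..k}. ennreal (lam i) *
      (\<integral>\<^sup>+ z. ennreal (norm1 (fst z - snd z)) \<partial>\<pi> i))"
    by (intro mult_left_mono sum_mono gc) auto
  finally show ?thesis .
qed

section \<open>Passing to the infima\<close>

text \<open>Near-optimal couplings suffice: for fixed \<open>Q\<close> their error tends to 0, and
  the infimum over \<open>Q\<close> is taken afterwards.\<close>

lemma mmot_value_le_barycenter_value:
  fixes x :: "nat \<Rightarrow> nat \<Rightarrow> real ^ 'd"
  assumes lam: "\<And>i. i \<in> {1..k} \<Longrightarrow> 0 \<le> lam i"
    and lam_sum: "(\<Sum>i\<in>{1..k}. lam i) = 1"
    and S: "finite S" "S \<noteq> {}"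
    and p: "\<And>i j. i \<in> {1..k} \<Longrightarrow> j \<in> {1..m i} \<Longrightarrow> 0 \<le> p i j"
    and p_sum: "\<And>i. i \<in> {1..k} \<Longrightarrow> (\<Sum>j\<in>{1..m i}. p i j) = 1"
    and inj: "\<And>i. i \<in> {1..k} \<Longrightarrow> inj_on (x i) {1..m i}"
    and c: "0 \<le> c"
    and cost: "\<And>j y. j \<in> multi_indices k m \<Longrightarrow>
      mmot_cost k lam x S j \<le> c * (\<Sum>i\<in>{1..k}. lam i * norm1 (y - x i (j i)))"
  shows "ennreal (mmot_value k lam m p x S)
    \<le> ennreal c * barycenter_value k lam (\<lambda>i. discrete_measure (m i) (p i) (x i))"
proof -
  let ?P = "\<lambda>i. discrete_measure (m i) (p i) (x i)"
  have k: "1 \<le> k" using lam_sum by (cases k) auto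
  have lam1: "(\<Sum>i\<in>{1..k}. ennreal (lam i)) = 1"
    using lam lam_sum by (subst sum_ennreal) auto
  have le: "ennreal (mmot_value k lam m p x S)
      \<le> ennreal c * (\<Sum>i\<in>{1..k}. ennreal (lam i) * W1 Q (?P i))" if Q: "Q \<in> prob_measures1" for Q
  proof (rule ennreal_le_epsilon)
    fix e :: real assume e: "0 < e"
    \<comment> \<open>The weights sum to 1, so an error \<open>d\<close> per coupling amounts to
      \<open>c * d\<close>; the added 1 avoids a zero denominator.\<close>
    define d where "d = e / (c + 1)"
    have d: "0 < d" "c * d \<le> e" using e c by (auto simp: d_def field_simps)
    have "\<exists>\<pi>. \<pi> \<in> couplings Q (?P i) \<and> (\<integral>\<^sup>+ z. ennreal (norm1 (fst z - snd z)) \<partial>\<pi>) \<le> W1 Q (?P i) + ennreal d"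
      if i: "i \<in> {1..k}" for i
    proof -
      \<comment> \<open>Finiteness makes adding \<open>d\<close> a strict increase, so some coupling
        costs less than the enlarged value.\<close>
      have fin: "W1 Q (?P i) < top"
        using W1_less_top[OF Q discrete_measure_in_prob_measures1[of "m i" "p i" "x i"]] p[OF i] p_sum[OF i]
        by simp
      then have "W1 Q (?P i) < W1 Q (?P i) + ennreal d"
        using d by (cases "W1 Q (?P i)") (auto simp flip: ennreal_plus simp: ennreal_less_iff)
      then show ?thesis
        unfolding W1_def[of Q "?P i"] INF_less_iff by (auto intro: less_imp_le)
    qed
    then obtain \<pi> where "\<forall>i\<in>{1..k}. \<pi> i \<in> couplings Q (?P i)
        \<and> (\<integral>\<^sup>+ z. ennreal (norm1 (fst z - snd z)) \<partial>\<pi> i) \<le> W1 Q (?P i) + ennreal d"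
      using bchoice[of "{1..k}" "\<lambda>i \<pi>. \<pi> \<in> couplings Q (?P i)
        \<and> (\<integral>\<^sup>+ z. ennreal (norm1 (fst z - snd z)) \<partial>\<pi>) \<le> W1 Q (?P i) + ennreal d"] by blast
    then have \<pi>: "\<And>i. i \<in> {1..k} \<Longrightarrow> \<pi> i \<in> couplings Q (?P i)"
      "\<And>i. i \<in> {1..k} \<Longrightarrow> (\<integral>\<^sup>+ z. ennreal (norm1 (fst z - snd z)) \<partial>\<pi> i) \<le> W1 Q (?P i) + ennreal d"
      by blast+
    have "ennreal (mmot_value k lam m p x S)
      \<le> ennreal c * (\<Sum>i\<in>{1..k}. ennreal (lam i) * (\<integral>\<^sup>+ z. ennreal (norm1 (fst z - snd z)) \<partial>\<pi> i))"
    proof (rule mmot_value_le_couplings)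
      show "prob_space Q" "sets Q = sets borel" using Q by (auto simp: prob_measures1_def)
    qed (fact lam S p inj \<pi>(1) k c cost)+
    also have "\<dots> \<le> ennreal c * (\<Sum>i\<in>{1..k}. ennreal (lam i) * (W1 Q (?P i) + ennreal d))"
      by (intro mult_left_mono sum_mono \<pi>) auto
    also have "\<dots> = ennreal c * (\<Sum>i\<in>{1..k}. ennreal (lam i) * W1 Q (?P i)) + ennreal (c * d)"
      using lam1 c d by (simp add: distrib_left sum.distrib ennreal_mult flip: sum_distrib_right)
    also have "\<dots> \<le> ennreal c * (\<Sum>i\<in>{1..k}. ennreal (lam i) * W1 Q (?P i)) + ennreal e"
      using d by (intro add_left_mono ennreal_leI)
    finally show "ennreal (mmot_value k lam m p x S)
      \<le> ennreal c * (\<Sum>i\<in>{1..k}. ennreal (lam i) * W1 Q (?P i)) + ennreal e" .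
  qed
  \<comment> \<open>Taken from the first given measure; for \<open>c = 0\<close> a single competitor
    already gives the bound.\<close>
  obtain Q where Q: "Q \<in> (prob_measures1 :: (real ^ 'd) measure set)"
    using discrete_measure_in_prob_measures1[of "m 1" "p 1" "x 1"] p p_sum k by fastforce
  show ?thesis
  proof (cases "c = 0")
    case True
    then show ?thesis using le[OF Q] by simp
  next
    case False
    \<comment> \<open>The reciprocal moves the constant to the left and leaves a bare infimum on the
      right.\<close>
    define r where "r = ennreal (1 / c)"
    have r: "r * ennreal c = 1"
      using c False by (simp add: r_def flip: ennreal_mult)
    have "r * ennreal (mmot_value k lam m p x S) \<le> barycenter_value k lam ?P"
      unfolding barycenter_value_def
    proof (rule INF_greatest)
      fix Q assume "Q \<in> (prob_measures1 :: (real ^ 'd) measure set)"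
      from mult_left_mono[OF le[OF this], of r]
      show "r * ennreal (mmot_value k lam m p x S) \<le> (\<Sum>i\<in>{1..k}. ennreal (lam i) * W1 Q (?P i))"
        by (simp add: r flip: mult.assoc)
    qed
    from mult_left_mono[OF this, of "ennreal c"] show ?thesis
      using r by (simp add: mult.commute flip: mult.assoc)
  qed
qed

section \<open>The factor 1 + (d - t) / d for the candidate set\<close>

theorem theorem8:
  fixes k n t :: nat
    and lam :: "nat \<Rightarrow> real"
    and m :: "nat \<Rightarrow> nat"
    and p :: "nat \<Rightarrow> nat \<Rightarrow> real"
    and x :: "nat \<Rightarrow> nat \<Rightarrow> real ^ 'd"
  assumes lam_nonneg: "\<And>i. i \<in> {1..k} \<Longrightarrow> 0 \<le> lam i"
    and lam_sum: "(\<Sum>i\<in>{1..k}. lam i) = 1"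
    and supp_card: "\<And>i. i \<in> {1..k} \<Longrightarrow> 1 \<le> m i \<and> m i \<le> n"
    and supp_inj: "\<And>i. i \<in> {1..k} \<Longrightarrow> inj_on (x i) {1..m i}"
    and p_nonneg: "\<And>i j. i \<in> {1..k} \<Longrightarrow> j \<in> {1..m i} \<Longrightarrow> 0 \<le> p i j"
    and p_sum: "\<And>i. i \<in> {1..k} \<Longrightarrow> (\<Sum>j\<in>{1..m i}. p i j) = 1"
    and t_le: "t \<le> CARD('d)"
  shows "ennreal (mmot_value k lam m p x (S3 (support_union k m x) t))
    \<le> ennreal (1 + (real CARD('d) - real t) / real CARD('d))
        * barycenter_value k lam (\<lambda>i. discrete_measure (m i) (p i) (x i))"
proof (rule mmot_value_le_barycenter_value)
  let ?U = "support_union k m x"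
  \<comment> \<open>Weights summing to 1 exclude \<open>k = 0\<close>, and the first support is
    nonempty.\<close>
  have "1 \<in> {1..k}" using lam_sum by (cases k) auto
  then have "?U \<noteq> {}"
    using supp_card[of 1] unfolding support_union_def by fastforce
  then show "S3 ?U t \<noteq> {}" by (rule S3_nonempty)
  show "finite (S3 ?U t)" by (intro finite_S3 finite_support_union)
  show "0 \<le> 1 + (real CARD('d) - real t) / real CARD('d)" using t_le by simp
  show "mmot_cost k lam x (S3 ?U t) j \<le> (1 + (real CARD('d) - real t) / real CARD('d))
      * (\<Sum>i\<in>{1..k}. lam i * norm1 (y - x i (j i)))" if "j \<in> multi_indices k m" for j y
    by (rule mmot_cost_S3_le[OF lam_nonneg lam_sum t_le that])
qed (use assms in auto)

end
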